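(* Let $M\in\mathbb{C}^{p\times p}$ be nonsingular, let $\mathcal{A}\in\mathbb{C}^{m\times m\times p}$ have tubal index $k$, and let $\mathcal{B}\in\mathbb{C}^{m\times 1\times p}$. If $\mathcal{B}\in\mathscr{R}_M(\mathcal{A}^k)$, then $\mathcal{A}^{\mathrm D,\dagger}*_M\mathcal{B}$ is the unique solution of $\mathcal{A}*_M\mathcal{X}=\mathcal{B}$ in $\mathscr{R}_M(\mathcal{A}^{\mathrm D}*_M\mathcal{A}^k)$.
   Context: Transform: for $\mathcal{A}\in\mathbb{C}^{m\times n\times p}$, $\tilde{\mathcal{A}}=\mathcal{A}\times_3 M\in\mathbb{C}^{m\times n\times p}$ is given by $(\tilde{\mathcal{A}})_{ijk}=\sum_{s=1}^p(\mathcal{A})_{ijs}M_{ks}$, and $\tilde{\mathcal{A}}^{(i)}=\tilde{\mathcal{A}}(:,:,i)$ is its $i$th frontal slice. Since $M$ is nonsingular, $\mathcal{A}\mapsto\tilde{\mathcal{A}}$ is a bijection. $M$-product: for $\mathcal{A}\in\mathbb{C}^{m\times n\times p}$, $\mathcal{B}\in\mathbb{C}^{n\times l\times p}$, $\mathcal{A}*_M\mathcal{B}$ is the unique $\mathcal{C}\in\mathbb{C}^{m\times l\times p}$ with $\tilde{\mathcal{C}}^{(i)}=\tilde{\mathcal{A}}^{(i)}\tilde{\mathcal{B}}^{(i)}$, $i=1,\dots,p$. The identity tensor $\mathcal{I}$ has $\tilde{\mathcal{I}}^{(i)}=I_m$ for all $i$; powers are taken with respect to $*_M$, with $\mathcal{A}^0=\mathcal{I}$.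 The conjugate transpose $\mathcal{A}^*$ is the tensor whose transform has $i$th frontal slice $(\tilde{\mathcal{A}}^{(i)})^{*}$ (matrix conjugate transpose). Range: $\mathscr{R}_M(\mathcal{A})=\{\mathcal{A}*_M\mathcal{Z}:\mathcal{Z}\in\mathbb{C}^{n\times 1\times p}\}$ for $\mathcal{A}\in\mathbb{C}^{m\times n\times p}$. Tubal index of $\mathcal{A}\in\mathbb{C}^{m\times m\times p}$: $k=\max_{1\le i\le p}\mathrm{ind}(\tilde{\mathcal{A}}^{(i)})$, where $\mathrm{ind}(A)$ is the least integer $k\ge 0$ with $\mathrm{rank}(A^k)=\mathrm{rank}(A^{k+1})$. Drazin inverse: for $\mathcal{A}$ of tubal index $k$, $\mathcal{A}^{\mathrm D}$ is the unique $\mathcal{X}\in\mathbb{C}^{m\times m\times p}$ with $\mathcal{X}*_M\mathcal{A}*_M\mathcal{X}=\mathcal{X}$, $\mathcal{A}*_M\mathcal{X}=\mathcal{X}*_M\mathcal{A}$ and $\mathcal{X}*_M\mathcal{A}^{k+1}=\mathcal{A}^k$. Moore–Penrose inverse: $\mathcal{A}^\dagger$ is the unique $\mathcal{X}$ with $\mathcal{A}*_M\mathcal{X}*_M\mathcal{A}=\mathcal{A}$, $\mathcal{X}*_M\mathcal{A}*_M\mathcal{X}=\mathcal{X}$, $(\mathcal{A}*_M\mathcal{X})^*=\mathcal{A}*_M\mathcal{X}$, $(\mathcal{X}*_M\mathcal{A})^*=\mathcal{X}*_M\mathcal{A}$. DMP inverse: $\mathcal{A}^{\mathrm D,\dagger}=\mathcal{A}^{\mathrm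 D}*_M\mathcal{A}*_M\mathcal{A}^\dagger$. *)

theory Defs
  imports "HOL-Analysis.Analysis"
begin

text \<open>
  A tensor in \<open>\<complex>\<^bsup>m\<times>n\<times>p\<^esup>\<close> is indexed as \<open>A $ i $ j $ k\<close>, so the type lists the dimensions in
  reverse order.  The matrix \<open>M\<close> of the transform is an explicit argument throughout; the
  definite descriptions below denote what they should only when \<open>M\<close> is invertible.
\<close>

type_synonym ('m, 'n, 'p) tensor = "complex ^ 'p ^ 'n ^ 'm"

definition transform ::
    "complex^'p^'p \<Rightarrow> ('m::finite, 'n::finite, 'p::finite) tensor \<Rightarrow> ('m, 'n, 'p) tensor"
  where "transform M A = (\<chi> i j k. \<Sum>s\<in>UNIV. A $ i $ j $ s * M $ k $ s)"

definition frontal_slice ::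
    "('m::finite, 'n::finite, 'p::finite) tensor \<Rightarrow> 'p \<Rightarrow> complex^'n^'m"
  where "frontal_slice A k = (\<chi> i j. A $ i $ j $ k)"

definition tensor_of_slices ::
    "complex^'p^'p \<Rightarrow> ('p \<Rightarrow> complex^'n^'m) \<Rightarrow> ('m::finite, 'n::finite, 'p::finite) tensor"
  where "tensor_of_slices M S = (THE C. \<forall>i. frontal_slice (transform M C) i = S i)"

lemma frontal_slice_transform:
  "frontal_slice (transform M A) k $ i $ j = (M *v (A $ i $ j)) $ k"
  by (simp add: frontal_slice_def transform_def matrix_vector_mult_def mult.commute)

lemma ex1_tensor_of_slices:
  fixes M :: "complex^'p^'p" and S :: "'p \<Rightarrow> complex^'n^'m"
  assumes "invertible M"
  shows "\<exists>!C :: ('m::finite, 'n::finite, 'p::finite) tensor.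
           \<forall>i. frontal_slice (transform M C) i = S i"
proof -
  obtain N where N: "M ** N = mat 1" "N ** M = mat 1"
    using assms unfolding invertible_def by blast
  have M_N: "M *v (N *v x) = x" and N_M: "N *v (M *v x) = x" for x
    by (simp_all add: matrix_vector_mul_assoc N)
  let ?C = "(\<chi> i j. N *v (\<chi> k. S k $ i $ j)) :: ('m, 'n, 'p) tensor"
  show ?thesis
  proof (rule ex1I[of _ ?C])
    show "\<forall>i. frontal_slice (transform M ?C) i = S i"
      by (simp add: vec_eq_iff frontal_slice_transform M_N)
  next
    fix C :: "('m, 'n, 'p) tensor"
    assume C: "\<forall>i. frontal_slice (transform M C) i = S i"
    have "M *v (C $ i $ j) = (\<chi> k. S k $ i $ j)" for i j
      using C by (simp add: vec_eq_iff frontal_slice_transform)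
    then have "C $ i $ j = N *v (\<chi> k. S k $ i $ j)" for i j
      by (metis N_M)
    then show "C = ?C"
      by (simp add: vec_eq_iff)
  qed
qed

lemma frontal_slice_tensor_of_slices:
  fixes M :: "complex^'p^'p" and S :: "'p::finite \<Rightarrow> complex^'n::finite^'m::finite"
  assumes "invertible M"
  shows "frontal_slice (transform M (tensor_of_slices M S)) i = S i"
  using theI'[OF ex1_tensor_of_slices[OF assms, of S]]
  unfolding tensor_of_slices_def by blast

definition mprod ::
    "complex^'p^'p \<Rightarrow> ('m::finite, 'n::finite, 'p::finite) tensor
      \<Rightarrow> ('n, 'l::finite, 'p) tensor \<Rightarrow> ('m, 'l, 'p) tensor"
  where "mprod M A B = tensor_of_slices M
    (\<lambda>i. frontal_slice (transform M A) i ** frontal_slice (transform M B) i)"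

definition identity_tensor :: "complex^'p^'p \<Rightarrow> ('m::finite, 'm, 'p::finite) tensor"
  where "identity_tensor M = tensor_of_slices M (\<lambda>i. mat 1)"

primrec tensor_power ::
    "complex^'p^'p \<Rightarrow> ('m::finite, 'm, 'p::finite) tensor \<Rightarrow> nat \<Rightarrow> ('m, 'm, 'p) tensor"
  where
    "tensor_power M A 0 = identity_tensor M"
  | "tensor_power M A (Suc n) = mprod M A (tensor_power M A n)"

definition tensor_ctranspose ::
    "complex^'p^'p \<Rightarrow> ('m::finite, 'n::finite, 'p::finite) tensor \<Rightarrow> ('n, 'm, 'p) tensor"
  where "tensor_ctranspose M A = tensor_of_slices M
    (\<lambda>i. map_matrix cnj (transpose (frontal_slice (transform M A) i)))"

text \<open>Column tensors in \<open>\<complex>\<^bsup>m\<times>1\<times>p\<^esup>\<close> use the one-element index type \<open>1\<close>.\<close>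

definition tensor_range ::
    "complex^'p^'p \<Rightarrow> ('m::finite, 'n::finite, 'p::finite) tensor \<Rightarrow> ('m, 1, 'p) tensor set"
  where "tensor_range M A = {mprod M A Z | Z :: ('n, 1, 'p) tensor. True}"

text \<open>The operation \<open>^\<close> on vectors would be componentwise, hence a separate matrix power.\<close>

primrec matrix_power :: "complex^'m^'m \<Rightarrow> nat \<Rightarrow> complex^'m^'m"
  where
    "matrix_power A 0 = mat 1"
  | "matrix_power A (Suc n) = A ** matrix_power A n"

definition matrix_index :: "complex^'m^'m \<Rightarrow> nat"
  where "matrix_index A =
    (LEAST k. rank (matrix_power A k) = rank (matrix_power A (k + 1)))"

definition tubal_index ::
    "complex^'p^'p \<Rightarrow> ('m::finite, 'm, 'p::finite) tensor \<Rightarrow> nat"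
  where "tubal_index M A = (MAX i. matrix_index (frontal_slice (transform M A) i))"

definition drazin_inverse ::
    "complex^'p^'p \<Rightarrow> ('m::finite, 'm, 'p::finite) tensor \<Rightarrow> ('m, 'm, 'p) tensor"
  where "drazin_inverse M A = (THE X.
      mprod M (mprod M X A) X = X \<and>
      mprod M A X = mprod M X A \<and>
      mprod M X (tensor_power M A (tubal_index M A + 1)) = tensor_power M A (tubal_index M A))"

definition moore_penrose_inverse ::
    "complex^'p^'p \<Rightarrow> ('m::finite, 'n::finite, 'p::finite) tensor \<Rightarrow> ('n, 'm, 'p) tensor"
  where "moore_penrose_inverse M A = (THE X.
      mprod M (mprod M A X) A = A \<and>
      mprod M (mprod M X A) X = X \<and>
      tensor_ctranspose M (mprod M A X) = mprod M A X \<and>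
      tensor_ctranspose M (mprod M X A) = mprod M X A)"

definition dmp_inverse ::
    "complex^'p^'p \<Rightarrow> ('m::finite, 'm, 'p::finite) tensor \<Rightarrow> ('m, 'm, 'p) tensor"
  where "dmp_inverse M A =
    mprod M (mprod M (drazin_inverse M A) A) (moore_penrose_inverse M A)"

end

theory Submission
  imports Defs
begin

text \<open>
  Under the transform the \<open>M\<close>-product is the matrix product of frontal slices, so tensors obey
  the algebra of matrices with involution.  Let \<open>D\<close> be the Drazin and \<open>P\<close> the Moore--Penrose
  inverse of \<open>A\<close>.  Two identities carry the theorem.

  First, \<open>A D\<close> fixes the range of \<open>A\<^sup>k\<close>: since \<open>D\<close> commutes with \<open>A\<close>,
  \<open>A D A\<^sup>k = D A\<^bsup>k+1\<^esup> = A\<^sup>k\<close>.  Secondly, this equation exhibits \<open>A\<close> as a left factor of \<open>A\<^sup>k\<close>,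
  also for \<open>k = 0\<close>, so \<open>A P A\<^sup>k = A\<^sup>k\<close>, as \<open>A P A = A\<close>.  Hence, for \<open>B = A\<^sup>k Z\<close>, the DMP inverse
  acts on \<open>B\<close> as the Drazin inverse, \<open>D A P B = D B = D A\<^sup>k Z\<close>; this lies in the range of \<open>D A\<^sup>k\<close>
  and \<open>A\<close> maps it to \<open>B\<close>.  If \<open>X = D A\<^sup>k W\<close> is another solution in that range, then
  \<open>B = A X = A\<^sup>k W\<close>, whence \<open>X = D B\<close>.

  Most of the work goes into the existence and uniqueness of the two inverses, which are defined
  by definite descriptions.  Both rest on factorizations that can be found slice by slice:
  \<open>A\<^sup>k = V A\<^bsup>k+1\<^esup> = A\<^bsup>k+1\<^esup> W\<close> for the Drazin inverse, from the stabilization of ranks, and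
  \<open>A = Z A\<^sup>* A = A A\<^sup>* Z'\<close> for the Moore--Penrose inverse, from \<open>ker (A\<^sup>* A) = ker A\<close>.  From these
  factorizations, explicit formulas give the inverses.
\<close>

section \<open>Factorizations of matrices\<close>

lemma matrix_vector_mult_axis: "A *v axis j 1 = column j A"
  for A :: "'a::field^'n^'m"
  by (simp add: vec_eq_iff matrix_vector_mult_def column_def axis_def if_distrib cong: if_cong)

lemma range_subset_imp_right_factor:
  fixes A :: "'a::field^'n^'m" and B :: "'a^'l^'m"
  assumes "range ((*v) A) \<subseteq> range ((*v) B)"
  shows "\<exists>W. A = B ** W"
proof -
  have "\<exists>w. A *v axis j 1 = B *v w" for j
    using assms by blast
  then obtain g where g: "\<And>j. A *v axis j 1 = B *v g j"
    by metis
  define W :: "'a^'n^'l" where "W = (\<chi> i j. g j $ i)"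
  have "column j A = column j (B ** W)" for j
  proof -
    have "column j (B ** W) = B *v g j"
      by (simp add: vec_eq_iff column_def matrix_matrix_mult_def matrix_vector_mult_def W_def)
    then show ?thesis
      using g[of j] by (simp add: matrix_vector_mult_axis)
  qed
  then have "A = B ** W"
    by (simp add: vec_eq_iff column_def)
  then show ?thesis
    by blast
qed

text \<open>
  A linear section \<open>g\<close> of \<open>B\<close> over its range satisfies \<open>g (B x) - x \<in> ker B\<close>, hence
  \<open>A (g (B x)) = A x\<close>.
\<close>

lemma kernel_subset_imp_left_factor:
  fixes A :: "'a::field^'n^'m" and B :: "'a^'n^'l"
  assumes ker: "\<And>x. B *v x = 0 \<Longrightarrow> A *v x = 0"
  shows "\<exists>V. A = V ** B"
proof -
  obtain g where g: "Vector_Spaces.linear (*s) (*s) g" "\<And>x. B *v g (B *v x) = B *v x"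
    using vec.linear_exists_right_inverse_on[OF matrix_vector_mul_linear_gen vec.subspace_UNIV, of B]
    by blast
  have "A *v x = (A ** matrix g ** B) *v x" for x
  proof -
    have "B *v (g (B *v x) - x) = 0"
      by (simp add: matrix_vector_mult_diff_distrib g(2))
    then have "A *v g (B *v x) = A *v x"
      using ker by (fastforce simp: matrix_vector_mult_diff_distrib)
    then show ?thesis
      by (simp add: matrix_vector_mul_assoc[symmetric] matrix_works[OF g(1)])
  qed
  then have "A = A ** matrix g ** B"
    by (simp add: matrix_eq)
  then show ?thesis
    by blast
qed

lemma subspace_range_matrix: "vec.subspace (range ((*v) A))"
  for A :: "'a::field^'n^'m"
  by (rule vec.linear_subspace_image[OF matrix_vector_mul_linear_gen vec.subspace_UNIV])

lemma span_columns_eq_range: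
  fixes A :: "'a::field^'n^'m"
  shows "vec.span (columns A) = range ((*v) A)"
proof
  have "columns A \<subseteq> range ((*v) A)"
    by (auto simp: columns_def matrix_vector_mult_axis[symmetric])
  then show "vec.span (columns A) \<subseteq> range ((*v) A)"
    by (rule vec.span_minimal) (rule subspace_range_matrix)
  show "range ((*v) A) \<subseteq> vec.span (columns A)"
    by (auto intro: matrix_vector_mult_in_columnspace_gen)
qed

lemma rank_eq_dim_range_transpose:
  fixes A :: "'a::field^'n^'m"
  shows "rank A = vec.dim (range ((*v) (transpose A)))"
  by (metis row_rank_def_gen columns_transpose span_columns_eq_range vec.dim_span)

lemma range_matrix_mult_subset: "range ((*v) (A ** B)) \<subseteq> range ((*v) A)"
  for A :: "'a::field^'n^'m"
  by (auto simp: matrix_vector_mul_assoc[symmetric])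

lemma rank_matrix_mult_le_right:
  fixes Y :: "'a::field^'n^'m" and X :: "'a^'l^'n"
  shows "rank (Y ** X) \<le> rank X"
  unfolding rank_eq_dim_range_transpose matrix_transpose_mul
  by (intro vec.dim_subset range_matrix_mult_subset)

text \<open>The row space of \<open>Y X\<close> lies in that of \<open>X\<close>, so equal dimensions force equality.\<close>

lemma rank_eq_imp_left_factor:
  fixes Y :: "'a::field^'n^'m" and X :: "'a^'l^'n"
  assumes "rank (Y ** X) = rank X"
  shows "\<exists>V. X = V ** (Y ** X)"
proof -
  have "range ((*v) (transpose (Y ** X))) = range ((*v) (transpose X))"
  proof (rule vec.subspace_dim_equal[OF subspace_range_matrix subspace_range_matrix])
    show "range ((*v) (transpose (Y ** X))) \<subseteq> range ((*v) (transpose X))"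
      unfolding matrix_transpose_mul by (rule range_matrix_mult_subset)
    show "vec.dim (range ((*v) (transpose X))) \<le> vec.dim (range ((*v) (transpose (Y ** X))))"
      using assms unfolding rank_eq_dim_range_transpose by (rule eq_refl[OF sym])
  qed
  then obtain W where "transpose X = transpose (Y ** X) ** W"
    using range_subset_imp_right_factor[of "transpose X" "transpose (Y ** X)"] by blast
  then have "X = transpose W ** (Y ** X)"
    by (metis matrix_transpose_mul transpose_transpose)
  then show ?thesis
    by blast
qed

lemma matrix_power_Suc_right: "matrix_power A (Suc n) = matrix_power A n ** A"
  by (induction n) (simp_all add: matrix_mul_assoc)

text \<open>The ranks of the powers decrease, so they cannot drop at every step.\<close>

lemma rank_matrix_power_matrix_index:
  "rank (matrix_power A (Suc (matrix_index A))) = rank (matrix_power A (matrix_index A))"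
proof -
  let ?r = "\<lambda>k. rank (matrix_power A k)"
  have "\<exists>k. ?r k = ?r (k + 1)"
  proof (rule ccontr)
    assume "\<not> ?thesis"
    then have less: "?r (Suc k) < ?r k" for k
      using rank_matrix_mult_le_right[of A "matrix_power A k"]
      by (metis Suc_eq_plus1 le_neq_implies_less matrix_power.simps(2))
    show False
      by (rule wf_no_infinite_down_chainE[OF wf_less_than, of ?r])
        (simp add: less del: matrix_power.simps)
  qed
  from LeastI_ex[OF this] show ?thesis
    by (simp add: matrix_index_def)
qed

lemma matrix_power_left_factor:
  assumes "matrix_index A \<le> k"
  shows "\<exists>V. matrix_power A k = V ** matrix_power A (Suc k)"
  using assms
proof (induction k rule: dec_induct)
  case base
  show ?case
    using rank_eq_imp_left_factor[OF rank_matrix_power_matrix_index[of A,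
          unfolded matrix_power.simps]]
    by (simp only: matrix_power.simps)
next
  case (step n)
  then obtain V where V: "matrix_power A n = V ** matrix_power A (Suc n)"
    by blast
  have "matrix_power A (Suc n) = V ** matrix_power A (Suc (Suc n))"
    unfolding matrix_power_Suc_right[of A "Suc n"] matrix_mul_assoc V[symmetric]
    by (rule matrix_power_Suc_right)
  then show ?case
    by blast
qed

text \<open>
  The left factorization makes \<open>A\<close> injective on the range of \<open>A\<^sup>k\<close>.  As \<open>A\<close> maps this
  finite-dimensional space into itself, it does so surjectively.
\<close>

lemma matrix_power_right_factor:
  fixes A :: "complex^'m^'m"
  assumes "matrix_index A \<le> k"
  shows "\<exists>W. matrix_power A k = matrix_power A (Suc k) ** W"
proof (rule range_subset_imp_right_factor)
  let ?R = "range ((*v) (matrix_power A k))"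
  obtain V where V: "matrix_power A k = V ** matrix_power A (Suc k)"
    using matrix_power_left_factor[OF assms] by blast
  have img: "(*v) A ` ?R = range ((*v) (matrix_power A (Suc k)))"
    by (simp add: image_image matrix_vector_mul_assoc)
  have sub: "vec.subspace ?R"
    by (rule subspace_range_matrix)
  have "V *v (A *v y) = y" if "y \<in> ?R" for y
  proof -
    obtain x where x: "y = matrix_power A k *v x"
      using \<open>y \<in> ?R\<close> by blast
    have "V *v (A *v y) = (V ** matrix_power A (Suc k)) *v x"
      by (simp add: x matrix_vector_mul_assoc matrix_mul_assoc)
    then show ?thesis
      by (simp only: V[symmetric] x)
  qed
  then have "inj_on ((*v) A) ?R"
    by (rule inj_on_inverseI)
  then have "inj_on ((*v) A) (vec.span ?R)"
    using sub by (simp only: vec.span_eq_iff[THEN iffD2])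
  then have "vec.dim ((*v) A ` ?R) = vec.dim ?R"
    by (rule vec.dim_image_eq[OF matrix_vector_mul_linear_gen])
  moreover have "(*v) A ` ?R \<subseteq> ?R"
    unfolding img matrix_power_Suc_right by (rule range_matrix_mult_subset)
  moreover have "vec.subspace ((*v) A ` ?R)"
    by (rule vec.linear_subspace_image[OF matrix_vector_mul_linear_gen sub])
  ultimately have "(*v) A ` ?R = ?R"
    using sub by (intro vec.subspace_dim_equal) auto
  then show "?R \<subseteq> range ((*v) (matrix_power A (Suc k)))"
    unfolding img by (rule eq_refl[OF sym])
qed

abbreviation ctranspose :: "complex^'n^'m \<Rightarrow> complex^'m^'n"
  where "ctranspose A \<equiv> map_matrix cnj (transpose A)"

lemma ctranspose_mult: "ctranspose (A ** B) = ctranspose B ** ctranspose A"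
  by (simp add: vec_eq_iff transpose_def matrix_matrix_mult_def mult.commute)

lemma ctranspose_ctranspose: "ctranspose (ctranspose A) = A"
  by (simp add: vec_eq_iff transpose_def)

text \<open>If \<open>A\<^sup>* A x = 0\<close>, then \<open>\<parallel>A x\<parallel>\<^sup>2 = \<langle>A\<^sup>* A x, x\<rangle> = 0\<close>.\<close>

lemma ctranspose_mult_self_kernel:
  assumes "(ctranspose A ** A) *v x = 0"
  shows "A *v x = 0"
proof -
  define y where "y = A *v x"
  have "ctranspose A *v y = 0"
    using assms by (simp only: matrix_vector_mul_assoc y_def)
  moreover have "(ctranspose A *v y) $ j = (\<Sum>i\<in>UNIV. cnj (A $ i $ j) * y $ i)" for j
    by (simp add: matrix_vector_mult_def transpose_def)
  ultimately have 0: "(\<Sum>i\<in>UNIV. cnj (A $ i $ j) * y $ i) = 0" for j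
    by (metis zero_index)
  have cnj_y: "cnj (y $ i) = (\<Sum>j\<in>UNIV. cnj (A $ i $ j) * cnj (x $ j))" for i
    by (simp add: y_def matrix_vector_mult_def)
  have "(\<Sum>i\<in>UNIV. cnj (y $ i) * y $ i)
      = (\<Sum>i\<in>UNIV. \<Sum>j\<in>UNIV. cnj (x $ j) * (cnj (A $ i $ j) * y $ i))"
    by (rule sum.cong[OF refl])
      (simp add: cnj_y sum_distrib_left sum_distrib_right mult_ac)
  also have "\<dots> = (\<Sum>j\<in>UNIV. cnj (x $ j) * (\<Sum>i\<in>UNIV. cnj (A $ i $ j) * y $ i))"
    by (subst sum.swap) (simp add: sum_distrib_left)
  also have "\<dots> = 0"
    by (simp add: 0)
  finally have "(\<Sum>i\<in>UNIV. complex_of_real ((cmod (y $ i))\<^sup>2)) = 0"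
    by (simp add: complex_norm_square mult.commute del: of_real_power)
  then have "(\<Sum>i\<in>UNIV. (cmod (y $ i))\<^sup>2) = 0"
    by (metis of_real_sum of_real_eq_0_iff)
  then have "y $ i = 0" for i
    by (simp add: sum_nonneg_eq_0_iff)
  then show ?thesis
    by (simp add: y_def vec_eq_iff)
qed

lemma left_factor_through_ctranspose:
  "\<exists>Z. A = Z ** (ctranspose A ** A)"
  by (rule kernel_subset_imp_left_factor) (rule ctranspose_mult_self_kernel)

section \<open>The algebra of tensors under the \<open>M\<close>-product\<close>

text \<open>
  Fixing \<open>M\<close> allows infix notation; as the dimensions \<open>m\<close> and \<open>n\<close> stay polymorphic, products of
  tensors of different shapes are covered.
\<close>

locale invertible_transform =
  fixes M :: "complex^'p::finite^'p"
  assumes invertible_M: "invertible M"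
begin

abbreviation slice :: "('m::finite, 'n::finite, 'p) tensor \<Rightarrow> 'p \<Rightarrow> complex^'n^'m"
  where "slice A \<equiv> frontal_slice (transform M A)"

abbreviation tprod :: "('m::finite, 'n::finite, 'p) tensor \<Rightarrow> ('n, 'l::finite, 'p) tensor
    \<Rightarrow> ('m, 'l, 'p) tensor"  (infixl "\<star>" 70)
  where "A \<star> B \<equiv> mprod M A B"

abbreviation tpow :: "('m::finite, 'm, 'p) tensor \<Rightarrow> nat \<Rightarrow> ('m, 'm, 'p) tensor"
    (infixr "\<up>" 80)
  where "A \<up> n \<equiv> tensor_power M A n"

abbreviation tct :: "('m::finite, 'n::finite, 'p) tensor \<Rightarrow> ('n, 'm, 'p) tensor"
  where "tct \<equiv> tensor_ctranspose M"

lemma tensor_eqI: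
  assumes "\<And>i. slice A i = slice B i"
  shows "A = B"
  using ex1_tensor_of_slices[OF invertible_M, of "slice B"] assms by blast

lemma slice_mprod: "slice (A \<star> B) i = slice A i ** slice B i"
  by (simp add: mprod_def frontal_slice_tensor_of_slices[OF invertible_M])

lemma slice_identity: "slice (identity_tensor M) i = mat 1"
  by (simp add: identity_tensor_def frontal_slice_tensor_of_slices[OF invertible_M])

lemma slice_tct: "slice (tct A) i = ctranspose (slice A i)"
  by (simp add: tensor_ctranspose_def frontal_slice_tensor_of_slices[OF invertible_M])

lemma slice_tpow: "slice (A \<up> n) i = matrix_power (slice A i) n"
  by (induction n) (simp_all add: slice_identity slice_mprod)

lemma tensor_choice:
  assumes "\<And>i. \<exists>S. P i S"
  obtains C where "\<And>i. P i (slice C i)"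
proof -
  obtain S where "\<And>i. P i (S i)"
    using assms by metis
  then show thesis
    using that[of "tensor_of_slices M S"]
    by (simp add: frontal_slice_tensor_of_slices[OF invertible_M])
qed

lemma tprod_assoc: "A \<star> B \<star> C = A \<star> (B \<star> C)"
  by (rule tensor_eqI) (simp add: slice_mprod matrix_mul_assoc)

lemma tprod_identity_left [simp]: "identity_tensor M \<star> A = A"
  by (rule tensor_eqI) (simp add: slice_mprod slice_identity)

lemma tprod_identity_right [simp]: "A \<star> identity_tensor M = A"
  by (rule tensor_eqI) (simp add: slice_mprod slice_identity)

lemma tct_tprod: "tct (A \<star> B) = tct B \<star> tct A"
  by (rule tensor_eqI) (simp add: slice_mprod slice_tct ctranspose_mult)

lemma tct_tct [simp]: "tct (tct A) = A"
  by (rule tensor_eqI) (simp add: slice_tct ctranspose_ctranspose)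

text \<open>
  With \<open>V = W\<close> this is the commutation of powers; the case of distinct \<open>V\<close> and \<open>W\<close> serves the
  two forms of the Drazin inverse.
\<close>

lemma tpow_intertwine:
  assumes "V \<star> C = C \<star> W"
  shows "V \<up> n \<star> C = C \<star> W \<up> n"
proof (induction n)
  case (Suc n)
  have "V \<up> Suc n \<star> C = V \<star> C \<star> W \<up> n"
    by (simp add: tprod_assoc Suc)
  then show ?case
    by (simp add: assms tprod_assoc)
qed simp

lemma tpow_commute: "A \<up> n \<star> A = A \<star> A \<up> n"
  by (rule tpow_intertwine) simp

lemma tpow_tpow_commute: "A \<up> m \<star> A \<up> n = A \<up> n \<star> A \<up> m"
  by (rule tpow_intertwine) (simp add: tpow_commute)

section \<open>The Moore--Penrose inverse\<close>

text \<open>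
  If \<open>A = Z A\<^sup>* A\<close>, then \<open>A Z\<^sup>* = Z A\<^sup>* A Z\<^sup>*\<close> is self-adjoint, so \<open>A Z\<^sup>* A = Z A\<^sup>* A = A\<close>.  If
  \<open>A = A A\<^sup>* W\<close>, then in the same way \<open>W\<^sup>* A\<close> is self-adjoint and \<open>A W\<^sup>* A = A\<close>.  The product
  \<open>W\<^sup>* A Z\<^sup>*\<close> combines both properties.
\<close>

lemma moore_penrose_exists:
  fixes A :: "('m::finite, 'n::finite, 'p) tensor"
  shows "\<exists>X. A \<star> X \<star> A = A \<and> X \<star> A \<star> X = X \<and> tct (A \<star> X) = A \<star> X \<and> tct (X \<star> A) = X \<star> A"
proof -
  have left_factor: "\<exists>Z. C = Z \<star> (tct C \<star> C)" for C :: "('k::finite, 'l::finite, 'p) tensor"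
  proof -
    obtain Z where "\<And>i. slice C i = slice Z i ** (ctranspose (slice C i) ** slice C i)"
      using tensor_choice[of "\<lambda>i Z. slice C i = Z ** (ctranspose (slice C i) ** slice C i)"]
        left_factor_through_ctranspose by blast
    then have "C = Z \<star> (tct C \<star> C)"
      by (intro tensor_eqI) (simp add: slice_mprod slice_tct)
    then show ?thesis
    by blast
  qed
  obtain Z where Z: "A = Z \<star> (tct A \<star> A)"
    using left_factor by blast
  obtain W' where W': "tct A = W' \<star> (tct (tct A) \<star> tct A)"
    using left_factor by blast
  define W where "W = tct W'"
  have W: "A = A \<star> (tct A \<star> W)"
    using arg_cong[OF W', of tct] by (simp add: W_def tct_tprod tprod_assoc)
  have "tct C = C" if "C = Z \<star> (tct A \<star> A) \<star> tct Z" for C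
    unfolding that by (simp add: tct_tprod tprod_assoc)
  from this[OF arg_cong[OF Z, of "\<lambda>C. C \<star> tct Z"]]
  have AZ: "tct (A \<star> tct Z) = A \<star> tct Z" .
  then have "A \<star> tct Z = Z \<star> tct A"
    by (simp only: tct_tprod tct_tct)
  then have AZA: "A \<star> tct Z \<star> A = A"
    by (simp only: tprod_assoc Z[symmetric])
  have "tct C = C" if "C = tct W \<star> (A \<star> (tct A \<star> W))" for C
    unfolding that by (simp add: tct_tprod tprod_assoc)
  from this[OF arg_cong[OF W, of "\<lambda>C. tct W \<star> C"]]
  have WA: "tct (tct W \<star> A) = tct W \<star> A" .
  then have "tct W \<star> A = tct A \<star> W"
    by (simp only: tct_tprod tct_tct)
  then have AWA: "A \<star> (tct W \<star> A) = A"
    by (simp only: W[symmetric])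
  define X where "X = tct W \<star> A \<star> tct Z"
  have AX: "A \<star> X = A \<star> tct Z"
    unfolding X_def using AWA by (metis tprod_assoc)
  have XA: "X \<star> A = tct W \<star> A"
    unfolding X_def using AZA by (metis tprod_assoc)
  have "X \<star> A \<star> X = X"
    unfolding XA unfolding X_def using AWA by (metis tprod_assoc)
  then show ?thesis
    using AX XA AZA AZ WA by metis
qed

text \<open>
  The self-adjoint products satisfy \<open>A X = (A Y A X)\<^sup>* = A X A Y = A Y\<close>, and similarly
  \<open>X A = Y A\<close>; thus \<open>X = X A X = Y A Y = Y\<close>.
\<close>

lemma moore_penrose_unique:
  assumes X: "A \<star> X \<star> A = A" "X \<star> A \<star> X = X" "tct (A \<star> X) = A \<star> X" "tct (X \<star> A) = X \<star> A"
    and Y: "A \<star> Y \<star> A = A" "Y \<star> A \<star> Y = Y" "tct (A \<star> Y) = A \<star> Y" "tct (Y \<star> A) = Y \<star> A"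
  shows "X = Y"
proof -
  have "A \<star> X = tct (A \<star> Y \<star> (A \<star> X))"
    using X Y by (metis tprod_assoc)
  also have "\<dots> = A \<star> X \<star> (A \<star> Y)"
    by (simp only: tct_tprod[of "A \<star> Y"] X Y)
  also have "\<dots> = A \<star> Y"
    using X by (metis tprod_assoc)
  finally have AX: "A \<star> X = A \<star> Y" .
  have "X \<star> A = tct (X \<star> A \<star> (Y \<star> A))"
    using X Y by (metis tprod_assoc)
  also have "\<dots> = Y \<star> A \<star> (X \<star> A)"
    by (simp only: tct_tprod[of "X \<star> A"] X Y)
  also have "\<dots> = Y \<star> A"
    using X by (metis tprod_assoc)
  finally have "X \<star> A = Y \<star> A" .
  then show ?thesis
    using AX X(2) Y(2) by (metis tprod_assoc)
qed

lemma moore_penrose_inner_inverse: "A \<star> moore_penrose_inverse M A \<star> A = A"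
proof -
  have "\<exists>!X. A \<star> X \<star> A = A \<and> X \<star> A \<star> X = X \<and> tct (A \<star> X) = A \<star> X \<and> tct (X \<star> A) = X \<star> A"
    using moore_penrose_exists[of A] moore_penrose_unique[of A] by blast
  from theI'[OF this] show ?thesis
    by (simp add: moore_penrose_inverse_def)
qed

section \<open>The Drazin inverse\<close>

lemma tpow_tubal_index_factors:
  obtains V W where "A \<up> tubal_index M A = V \<star> A \<up> Suc (tubal_index M A)"
    and "A \<up> tubal_index M A = A \<up> Suc (tubal_index M A) \<star> W"
proof -
  let ?k = "tubal_index M A"
  have le: "matrix_index (slice A i) \<le> ?k" for i
    by (simp add: tubal_index_def)
  obtain V where V: "\<And>i. matrix_power (slice A i) ?k = slice V i ** matrix_power (slice A i) (Suc ?k)"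
    using tensor_choice[of "\<lambda>i V. matrix_power (slice A i) ?k = V ** matrix_power (slice A i) (Suc ?k)"]
      matrix_power_left_factor[OF le] by blast
  obtain W where W: "\<And>i. matrix_power (slice A i) ?k = matrix_power (slice A i) (Suc ?k) ** slice W i"
    using tensor_choice[of "\<lambda>i W. matrix_power (slice A i) ?k = matrix_power (slice A i) (Suc ?k) ** W"]
      matrix_power_right_factor[OF le] by blast
  show thesis
  proof
    show "A \<up> ?k = V \<star> A \<up> Suc ?k"
      by (rule tensor_eqI) (simp only: slice_mprod slice_tpow V[symmetric])
    show "A \<up> ?k = A \<up> Suc ?k \<star> W"
      by (rule tensor_eqI) (simp only: slice_mprod slice_tpow W[symmetric])
  qed
qed

text \<open>
  In any monoid, \<open>A\<^sup>k = V A\<^bsup>k+1\<^esup> = A\<^bsup>k+1\<^esup> W\<close> says that \<open>A\<close> is strongly \<open>\<pi>\<close>-regular.  Then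
  \<open>V A\<^sup>k = V A\<^bsup>k+1\<^esup> W = A\<^sup>k W\<close>, so that \<open>V\<close> can be traded for \<open>W\<close> across \<open>A\<^sup>k\<close>; the Drazin inverse
  is \<open>V\<^bsup>k+1\<^esup> A\<^sup>k = A\<^sup>k W\<^bsup>k+1\<^esup>\<close>.  The form with \<open>V\<close> absorbs powers of \<open>A\<close> on the right and the
  form with \<open>W\<close> those on the left, so \<open>A X\<close> and \<open>X A\<close> both reduce to \<open>V\<^sup>k A\<^sup>k = A\<^sup>k W\<^sup>k\<close>.
\<close>

lemma drazin_exists:
  assumes V: "A \<up> k = V \<star> A \<up> Suc k" and W: "A \<up> k = A \<up> Suc k \<star> W"
  shows "\<exists>X. X \<star> A \<star> X = X \<and> A \<star> X = X \<star> A \<and> X \<star> A \<up> Suc k = A \<up> k"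
proof -
  have VW: "V \<up> n \<star> A \<up> k = A \<up> k \<star> W \<up> n" for n
    by (rule tpow_intertwine) (metis V W tprod_assoc)
  define X where "X = A \<up> k \<star> W \<up> Suc k"
  have X_V: "X = V \<up> Suc k \<star> A \<up> k"
    unfolding X_def by (rule VW[symmetric])
  have absorb: "V \<up> n \<star> (A \<up> n \<star> A \<up> k) = A \<up> k" for n
  proof (induction n)
    case (Suc n)
    have "V \<up> Suc n \<star> (A \<up> Suc n \<star> A \<up> k) = V \<up> n \<star> (V \<star> (A \<star> (A \<up> n \<star> A \<up> k)))"
      by (simp only: tensor_power.simps tpow_commute[symmetric, of V] tprod_assoc)
    also have "\<dots> = V \<up> n \<star> ((V \<star> A \<up> Suc k) \<star> A \<up> n)"
      by (simp only: tensor_power.simps tpow_tpow_commute[of A n k] tprod_assoc)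
    also have "\<dots> = A \<up> k"
      by (simp only: V[symmetric] tpow_tpow_commute[of A k n] Suc)
    finally show ?case .
  qed simp
  have XA: "X \<star> A \<up> Suc k = A \<up> k"
    using absorb[of "Suc k"] by (simp only: X_V tprod_assoc tpow_tpow_commute[of A k "Suc k"])
  have "A \<star> X = (A \<up> Suc k \<star> W) \<star> W \<up> k"
    by (simp add: X_def tprod_assoc)
  also have "\<dots> = V \<up> k \<star> A \<up> k"
    by (simp only: W[symmetric] VW)
  also have "\<dots> = V \<up> k \<star> (V \<star> A \<up> Suc k)"
    by (simp only: V[symmetric])
  also have "\<dots> = X \<star> A"
    by (simp only: X_V tensor_power.simps tpow_commute[symmetric] tprod_assoc)
  finally have AX: "A \<star> X = X \<star> A" .
  have "X \<star> A \<star> X = (X \<star> A \<up> Suc k) \<star> W \<up> Suc k"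
    by (simp add: X_def tprod_assoc)
  also have "\<dots> = X"
    by (simp only: XA) (simp only: X_def)
  finally have "X \<star> A \<star> X = X" .
  with AX XA show ?thesis
    by blast
qed

text \<open>
  For an outer inverse \<open>X\<close> that commutes with \<open>A\<close>, the idempotent \<open>X A\<close> equals \<open>X\<^sup>n A\<^sup>n\<close> for all
  \<open>n \<ge> 1\<close>.  It therefore has \<open>A\<^bsup>k+1\<^esup>\<close> as a factor, and there the equation
  \<open>X A\<^bsup>k+1\<^esup> = A\<^sup>k\<close> determines the action of a Drazin inverse.
\<close>

lemma commuting_outer_inverse_idempotent:
  assumes "X \<star> A \<star> X = X" and "A \<star> X = X \<star> A"
  shows "X \<up> Suc n \<star> A \<up> Suc n = X \<star> A"
proof (induction n)
  case (Suc n)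
  have "X \<up> Suc (Suc n) \<star> A \<up> Suc (Suc n) = X \<star> (X \<up> Suc n \<star> A \<up> Suc n) \<star> A"
    by (simp only: tensor_power.simps(2)[of M _ "Suc n"] tpow_commute[symmetric, of A]
        tprod_assoc)
  also have "\<dots> = X \<star> A"
    unfolding Suc using assms by (metis tprod_assoc)
  finally show ?case .
qed simp

text \<open>
  The idempotents \<open>E = X A\<close> and \<open>F = A Y\<close> both fix \<open>A\<^bsup>k+1\<^esup>\<close>, and each has \<open>A\<^bsup>k+1\<^esup>\<close> as a factor:
  \<open>E = X\<^bsup>k+1\<^esup> A\<^bsup>k+1\<^esup>\<close> and \<open>F = A\<^bsup>k+1\<^esup> Y\<^bsup>k+1\<^esup>\<close>.  Hence \<open>E = E F = F\<close>, and both \<open>X\<close> and \<open>Y\<close>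
  equal \<open>X A Y\<close>.
\<close>

lemma drazin_unique:
  assumes X: "X \<star> A \<star> X = X" "A \<star> X = X \<star> A" "X \<star> A \<up> Suc k = A \<up> k"
    and Y: "Y \<star> A \<star> Y = Y" "A \<star> Y = Y \<star> A" "Y \<star> A \<up> Suc k = A \<up> k"
  shows "X = Y"
proof -
  have commute: "A \<up> n \<star> C = C \<star> A \<up> n" if "A \<star> C = C \<star> A" for C n
    using that by (rule tpow_intertwine)
  have idem_X: "X \<star> A = X \<up> Suc k \<star> A \<up> Suc k"
    using commuting_outer_inverse_idempotent[OF X(1,2)] by simp
  have "A \<up> Suc k \<star> (A \<star> Y) = A \<star> (Y \<star> A \<up> Suc k)"
    using commute[OF Y(2), of "Suc k"] by (metis Y(2) tprod_assoc tpow_commute)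
  then have "A \<up> Suc k \<star> (A \<star> Y) = A \<up> Suc k"
    using Y(3) by simp
  then have EX: "X \<star> A \<star> (A \<star> Y) = X \<star> A"
    unfolding idem_X by (simp only: tprod_assoc)
  have "X = X \<star> (X \<star> A)"
    using X(1,2) by (metis tprod_assoc)
  also have "\<dots> = X \<star> (X \<star> A \<star> (A \<star> Y))"
    by (simp only: EX)
  also have "\<dots> = X \<star> A \<star> Y"
    using X(1,2) by (metis tprod_assoc)
  finally have 1: "X = X \<star> A \<star> Y" .
  have idem_Y: "A \<star> Y = A \<up> Suc k \<star> Y \<up> Suc k"
    using commuting_outer_inverse_idempotent[OF Y(1,2), of k]
      tpow_intertwine[OF commute[OF Y(2), of "Suc k", symmetric], of "Suc k"] Y(2) by simp
  have "X \<star> A \<star> A \<up> Suc k = A \<up> Suc k"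
    using X(2,3) by (metis tprod_assoc tensor_power.simps(2))
  then have EY: "X \<star> A \<star> (A \<star> Y) = A \<star> Y"
    unfolding idem_Y by (metis tprod_assoc)
  have "Y = A \<star> Y \<star> Y"
    using Y(1,2) by simp
  also have "\<dots> = X \<star> A \<star> (A \<star> Y) \<star> Y"
    by (simp only: EY)
  also have "\<dots> = X \<star> A \<star> Y"
    using Y(1,2) by (metis tprod_assoc)
  finally show ?thesis
    using 1 by simp
qed

lemma drazin_inverse_equations:
  shows "A \<star> drazin_inverse M A = drazin_inverse M A \<star> A"
    and "drazin_inverse M A \<star> A \<up> Suc (tubal_index M A) = A \<up> tubal_index M A"
proof -
  let ?k = "tubal_index M A"
  obtain V W where "A \<up> ?k = V \<star> A \<up> Suc ?k" "A \<up> ?k = A \<up> Suc ?k \<star> W"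
    by (rule tpow_tubal_index_factors)
  then have "\<exists>X. X \<star> A \<star> X = X \<and> A \<star> X = X \<star> A \<and> X \<star> A \<up> Suc ?k = A \<up> ?k"
    by (rule drazin_exists)
  then have "\<exists>!X. X \<star> A \<star> X = X \<and> A \<star> X = X \<star> A \<and> X \<star> A \<up> Suc ?k = A \<up> ?k"
    using drazin_unique[of _ A ?k] by blast
  from theI'[OF this]
  show "A \<star> drazin_inverse M A = drazin_inverse M A \<star> A"
    and "drazin_inverse M A \<star> A \<up> Suc ?k = A \<up> ?k"
    by (simp_all only: drazin_inverse_def Suc_eq_plus1)
qed

section \<open>The DMP inverse on the range of \<open>A\<^sup>k\<close>\<close>

lemma tprod_drazin_tpow_tubal_index:
  "A \<star> (drazin_inverse M A \<star> A \<up> tubal_index M A) = A \<up> tubal_index M A"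
  using drazin_inverse_equations[of A] by (metis tprod_assoc tensor_power.simps(2))

text \<open>
  Writing \<open>A\<^sup>k = A D A\<^sup>k\<close> exposes a left factor \<open>A\<close>, which \<open>A P\<close> fixes; this works for \<open>k = 0\<close> as
  well, where \<open>A\<^sup>k\<close> has no such factor by definition.
\<close>

lemma dmp_eq_drazin_on_tpow_tubal_index:
  "dmp_inverse M A \<star> A \<up> tubal_index M A = drazin_inverse M A \<star> A \<up> tubal_index M A"
proof -
  let ?k = "tubal_index M A" and ?D = "drazin_inverse M A" and ?P = "moore_penrose_inverse M A"
  have "A \<star> ?P \<star> A \<up> ?k = A \<star> ?P \<star> A \<star> (?D \<star> A \<up> ?k)"
    by (metis tprod_drazin_tpow_tubal_index tprod_assoc)
  also have "\<dots> = A \<up> ?k"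
    by (simp only: moore_penrose_inner_inverse tprod_drazin_tpow_tubal_index)
  finally show ?thesis
    by (simp add: dmp_inverse_def tprod_assoc)
qed

end

theorem theorem6p7:
  fixes M :: "complex^'p^'p"
    and A :: "('m::finite, 'm, 'p::finite) tensor"
    and B :: "('m, 1, 'p) tensor"
    and k :: nat
  assumes "invertible M"
    and "tubal_index M A = k"
    and "B \<in> tensor_range M (tensor_power M A k)"
  shows "mprod M (dmp_inverse M A) B
           \<in> tensor_range M (mprod M (drazin_inverse M A) (tensor_power M A k))
    \<and> mprod M A (mprod M (dmp_inverse M A) B) = B
    \<and> (\<forall>X \<in> tensor_range M (mprod M (drazin_inverse M A) (tensor_power M A k)).
          mprod M A X = B \<longrightarrow> X = mprod M (dmp_inverse M A) B)"
proof -
  interpret invertible_transform M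
    by unfold_locales (rule assms(1))
  let ?D = "drazin_inverse M A"
  obtain Z where Z: "B = mprod M (tensor_power M A k) Z"
    using assms(3) by (auto simp: tensor_range_def)
  have dmp_B: "mprod M (dmp_inverse M A) B = mprod M (mprod M ?D (tensor_power M A k)) Z"
    unfolding Z tprod_assoc[symmetric]
    using dmp_eq_drazin_on_tpow_tubal_index[of A] assms(2) by simp
  have A_D: "mprod M A (mprod M (mprod M ?D (tensor_power M A k)) Y)
      = mprod M (tensor_power M A k) Y" for Y :: "('m, 1, 'p) tensor"
    using tprod_drazin_tpow_tubal_index[of A] assms(2) by (metis tprod_assoc)
  have "X = mprod M (dmp_inverse M A) B"
    if X: "X \<in> tensor_range M (mprod M ?D (tensor_power M A k))" "mprod M A X = B" for X
  proof -
    obtain Y where Y: "X = mprod M (mprod M ?D (tensor_power M A k)) Y"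
      using X(1) by (auto simp: tensor_range_def)
    have "mprod M (tensor_power M A k) Y = mprod M (tensor_power M A k) Z"
      using X(2) A_D[of Y] by (simp add: Y Z)
    then show ?thesis
      by (simp only: dmp_B Y tprod_assoc)
  qed
  moreover have "mprod M (dmp_inverse M A) B \<in> tensor_range M (mprod M ?D (tensor_power M A k))"
    unfolding dmp_B tensor_range_def by blast
  moreover have "mprod M A (mprod M (dmp_inverse M A) B) = B"
    by (simp only: dmp_B A_D) (simp only: Z)
  ultimately show ?thesis
    by blast
qed

end
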